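(* Consider the stochastic linear regression model $X_k=\theta\phi_k+\varepsilon_k$, $k\in[1,n]$, with unknown parameter $\theta\in\mathbf{R}$ and least-squares estimator $$\theta_n=\frac{\sum_{k=1}^n\phi_kX_k}{\sum_{k=1}^n\phi_k^2}.$$ Assume that there exist $\alpha\in(1,2]$ and $c>0$ such that $$\mathbf{E}e^{\lambda\varepsilon_i}\le e^{c|\lambda|^\alpha}\quad\text{for all } i\in[1,n]\ \text{and all}\ \lambda\in\mathbf{R}.$$ Then, for all $x\ge0$ and $v>0$ and for each choice of sign $\pm$, $$\mathbf{P}\left(\pm(\theta_n-\theta)\sum_{k=1}^n\phi_k^2\ge x\ \text{and}\ \sum_{k=1}^n|\phi_k|^\alpha\le v^\alpha\right)\le\exp\left\{-C(\alpha)\left(\frac{x}{v}\right)^{\frac{\alpha}{\alpha-1}}\right\},$$ where $$C(\alpha)=(c\,\alpha)^{\frac{1}{1-\alpha}}\left(1-\alpha^{-1}\right).$$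
   Context: In the model, $X_k$, $\phi_k$, $\varepsilon_k$ are the (real-valued) observations, regression variables and driven noises. The sequence $(\phi_k)$ consists of independent random variables; $(\varepsilon_k)$ is a sequence of i.i.d. random variables with mean zero and variance $\sigma^2>0$; and the sequences $(\phi_k)$ and $(\varepsilon_k)$ are independent of each other. It is understood that $\sum_{k=1}^n\phi_k^2>0$ a.s., so that $\theta_n$ is defined. *)

theory Defs
  imports "HOL-Probability.Probability"
begin

text \<open>Where \<open>\<Sum>k=1..n. (\<phi> k \<omega>)\<^sup>2 = 0\<close> this is \<open>0\<close> by the convention \<open>a / 0 = 0\<close>; in the model
  that happens only on a null set.\<close>
definition least_squares_estimator ::
  "nat \<Rightarrow> (nat \<Rightarrow> 'a \<Rightarrow> real) \<Rightarrow> (nat \<Rightarrow> 'a \<Rightarrow> real) \<Rightarrow> 'a \<Rightarrow> real" where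
  "least_squares_estimator n \<phi> X \<omega> =
     (\<Sum>k=1..n. \<phi> k \<omega> * X k \<omega>) / (\<Sum>k=1..n. (\<phi> k \<omega>)\<^sup>2)"

definition rate_constant :: "real \<Rightarrow> real \<Rightarrow> real" where
  "rate_constant c \<alpha> = (c * \<alpha>) powr (1 / (1 - \<alpha>)) * (1 - 1 / \<alpha>)"

text \<open>Only the first \<open>n\<close> terms of the sequences enter the model, so nothing is required of the terms
  with index outside \<open>{1..n}\<close>. The last assumption forces \<open>n \<ge> 1\<close>.\<close>
locale stochastic_linear_regression = prob_space M
  for M :: "'a measure" +
  fixes n :: nat
    and \<theta> \<sigma> :: real
    and \<phi> \<epsilon> X :: "nat \<Rightarrow> 'a \<Rightarrow> real"
  assumes model: "\<And>k \<omega>. k \<in> {1..n} \<Longrightarrow> \<omega> \<in> space M \<Longrightarrow> X k \<omega> = \<theta> * \<phi> k \<omega> + \<epsilon> k \<omega>"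
    and regressors_indep: "indep_vars (\<lambda>_. borel) \<phi> {1..n}"
    and noise_indep: "indep_vars (\<lambda>_. borel) \<epsilon> {1..n}"
    and noise_ident_distr:
      "\<And>i j. i \<in> {1..n} \<Longrightarrow> j \<in> {1..n} \<Longrightarrow> distr M borel (\<epsilon> i) = distr M borel (\<epsilon> j)"
    and noise_integrable: "\<And>i. i \<in> {1..n} \<Longrightarrow> integrable M (\<epsilon> i)"
    and noise_mean: "\<And>i. i \<in> {1..n} \<Longrightarrow> expectation (\<epsilon> i) = 0"
    and noise_square_integrable: "\<And>i. i \<in> {1..n} \<Longrightarrow> integrable M (\<lambda>\<omega>. (\<epsilon> i \<omega>)\<^sup>2)"
    and noise_variance: "\<And>i. i \<in> {1..n} \<Longrightarrow> variance (\<epsilon> i) = \<sigma>\<^sup>2"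
    and noise_variance_pos: "\<sigma>\<^sup>2 > 0"
    and regressors_noise_indep:
      "indep_var (\<Pi>\<^sub>M k\<in>{1..n}. borel) (\<lambda>\<omega>. \<lambda>k\<in>{1..n}. \<phi> k \<omega>)
                 (\<Pi>\<^sub>M k\<in>{1..n}. borel) (\<lambda>\<omega>. \<lambda>k\<in>{1..n}. \<epsilon> k \<omega>)"
    and regressors_nondegenerate: "AE \<omega> in M. (\<Sum>k=1..n. (\<phi> k \<omega>)\<^sup>2) > 0"

end

theory Submission
  imports Defs
begin

text \<open>The error \<open>\<theta>\<^sub>n - \<theta>\<close> multiplied by \<open>\<Sum>\<phi>\<^sub>k\<^sup>2\<close> is the weighted noise \<open>\<Sum>\<phi>\<^sub>k \<epsilon>\<^sub>k\<close>. Since the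
  regressors are independent of the noise, they may be frozen at a deterministic vector \<open>p\<close> by
  Fubini, and Chernoff's bound for \<open>\<Sum>p\<^sub>k \<epsilon>\<^sub>k\<close> is uniform in \<open>p\<close> as long as
  \<open>\<Sum>\<bar>p\<^sub>k\<bar> powr \<alpha> \<le> v powr \<alpha>\<close>.\<close>

text \<open>By independence the joint law of \<open>X\<close> and \<open>Y\<close> is the product of
  their laws, so the probability is the average of the slice probabilities over the law of
  \<open>X\<close>, which has total mass 1.\<close>

lemma (in prob_space) prob_indep_le_if_slices_le:
  assumes indep: "indep_var S X T Y"
    and A: "A \<in> sets (S \<Otimes>\<^sub>M T)"
    and slice: "\<And>x. x \<in> space S \<Longrightarrow> prob {\<omega> \<in> space M. (x, Y \<omega>) \<in> A} \<le> b"
  shows "prob {\<omega> \<in> space M. (X \<omega>, Y \<omega>) \<in> A} \<le> b"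
proof -
  have X [measurable]: "X \<in> measurable M S" and Y [measurable]: "Y \<in> measurable M T"
    using indep by (auto dest: indep_var_rv1 indep_var_rv2)
  interpret X: prob_space "distr M S X" by (rule prob_space_distr) fact
  interpret Y: prob_space "distr M T Y" by (rule prob_space_distr) fact
  \<comment> \<open>\<open>ennreal b\<close> would truncate a negative \<open>b\<close> to 0, so the
    return to reals needs \<open>0 \<le> b\<close>. Any one slice gives it, and a slice exists
    because \<open>X\<close> maps the nonempty \<open>space M\<close> into
    \<open>space S\<close>.\<close>
  have "space S \<noteq> {}"
    using measurable_space[OF X] not_empty by auto
  then have b: "0 \<le> b"
    using slice by (meson all_not_in_conv measure_nonneg order_trans)
  have "emeasure M {\<omega> \<in> space M. (X \<omega>, Y \<omega>) \<in> A}
      = emeasure (distr M (S \<Otimes>\<^sub>M T) (\<lambda>\<omega>. (X \<omega>, Y \<omega>))) A"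
    using A by (subst emeasure_distr) (auto intro!: arg_cong[where f = "emeasure M"])
  also have "\<dots> = emeasure (distr M S X \<Otimes>\<^sub>M distr M T Y) A"
    using indep by (simp add: indep_var_distribution_eq)
  also have "\<dots> = (\<integral>\<^sup>+x. emeasure (distr M T Y) (Pair x -` A) \<partial>distr M S X)"
    by (rule Y.emeasure_pair_measure_alt) (use A in simp)
  also have "\<dots> \<le> (\<integral>\<^sup>+x. ennreal b \<partial>distr M S X)"
  proof (rule nn_integral_mono)
    fix x assume "x \<in> space (distr M S X)"
    then have x: "x \<in> space S" by simp
    have "emeasure (distr M T Y) (Pair x -` A) = emeasure M {\<omega> \<in> space M. (x, Y \<omega>) \<in> A}"
      using sets_Pair1[OF A] by (subst emeasure_distr) (auto intro!: arg_cong[where f = "emeasure M"])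
    then show "emeasure (distr M T Y) (Pair x -` A) \<le> ennreal b"
      using slice[OF x] by (simp add: emeasure_eq_measure ennreal_leI)
  qed
  also have "\<dots> = ennreal b"
    using X.emeasure_space_1 by simp
  finally show ?thesis
    using b by (simp add: emeasure_eq_measure)
qed

text \<open>Markov's inequality for \<open>exp (l * (\<Sum>i\<in>I. p i * Y i \<omega>))\<close>,
  whose expectation factorises by independence; each weight is absorbed into the argument
  \<open>t = l * p i\<close>. As \<open>expectation\<close> is 0 on non-integrable functions,
  \<open>mgf_bound\<close> says something about \<open>Y\<close> only together with
  \<open>mgf_finite\<close>.\<close>

lemma (in prob_space) weighted_sum_tail_le:
  fixes Y :: "'i \<Rightarrow> 'a \<Rightarrow> real" and p :: "'i \<Rightarrow> real"
  assumes I: "finite I"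
    and indep: "indep_vars (\<lambda>_. borel) Y I"
    and mgf_finite: "\<And>i t. i \<in> I \<Longrightarrow> integrable M (\<lambda>\<omega>. exp (t * Y i \<omega>))"
    and mgf_bound: "\<And>i t. i \<in> I \<Longrightarrow> expectation (\<lambda>\<omega>. exp (t * Y i \<omega>)) \<le> exp (c * \<bar>t\<bar> powr \<alpha>)"
    and l: "0 \<le> l"
  shows "prob {\<omega> \<in> space M. x \<le> (\<Sum>i\<in>I. p i * Y i \<omega>)}
    \<le> exp (c * l powr \<alpha> * (\<Sum>i\<in>I. \<bar>p i\<bar> powr \<alpha>) - l * x)"
proof -
  let ?Z = "\<lambda>i \<omega>. exp (l * p i * Y i \<omega>)"
  have indepZ: "indep_vars (\<lambda>_. borel) ?Z I"
    by (rule indep_vars_compose2[OF indep, where Y = "\<lambda>i y. exp (l * p i * y)"]) simp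
  have prodZ: "(\<Prod>i\<in>I. ?Z i \<omega>) = exp (l * (\<Sum>i\<in>I. p i * Y i \<omega>))" for \<omega>
    using I by (simp add: exp_sum sum_distrib_left mult.assoc)
  have int: "integrable M (\<lambda>\<omega>. exp (l * (\<Sum>i\<in>I. p i * Y i \<omega>)))"
    using indep_vars_integrable[OF I indepZ] mgf_finite by (simp add: prodZ)
  have [measurable]: "(\<lambda>\<omega>. \<Sum>i\<in>I. p i * Y i \<omega>) \<in> borel_measurable M"
    using indep unfolding indep_vars_def by (auto intro!: borel_measurable_sum borel_measurable_times)
  have "prob {\<omega> \<in> space M. x \<le> (\<Sum>i\<in>I. p i * Y i \<omega>)}
      \<le> prob {\<omega> \<in> space M. exp (l * x) \<le> exp (l * (\<Sum>i\<in>I. p i * Y i \<omega>))}"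
    using l by (intro finite_measure_mono) (auto intro: mult_left_mono)
  also have "\<dots> \<le> expectation (\<lambda>\<omega>. exp (l * (\<Sum>i\<in>I. p i * Y i \<omega>))) / exp (l * x)"
    using integral_Markov_inequality_measure[OF int, where A = "{}" and c = "exp (l * x)"] by simp
  also have "expectation (\<lambda>\<omega>. exp (l * (\<Sum>i\<in>I. p i * Y i \<omega>))) = (\<Prod>i\<in>I. expectation (?Z i))"
    using indep_vars_lebesgue_integral[OF I indepZ] mgf_finite by (simp add: prodZ)
  also have "\<dots> \<le> (\<Prod>i\<in>I. exp (c * \<bar>l * p i\<bar> powr \<alpha>))"
    by (intro prod_mono conjI mgf_bound integral_nonneg_AE) auto
  also have "\<dots> = exp (c * l powr \<alpha> * (\<Sum>i\<in>I. \<bar>p i\<bar> powr \<alpha>))"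
    using I l by (simp add: exp_sum sum_distrib_left abs_mult powr_mult mult.assoc)
  finally show ?thesis
    by (simp add: exp_diff divide_right_mono)
qed

text \<open>The left-hand side is minimal at \<open>l = (x / (c * \<alpha> * v powr \<alpha>)) powr (1 / (\<alpha> - 1))\<close>.\<close>

lemma chernoff_exponent_min:
  fixes \<alpha> c v x :: real
  assumes "1 < \<alpha>" and c: "0 < c" and "0 < v" "0 \<le> x"
  obtains l where "0 \<le> l"
    "c * l powr \<alpha> * v powr \<alpha> - l * x = - rate_constant c \<alpha> * (x / v) powr (\<alpha> / (\<alpha> - 1))"
proof (cases "x = 0")
  case True
  \<comment> \<open>Both sides are 0, since \<open>0 powr a = 0\<close> for every
    \<open>a\<close>.\<close>
  then show ?thesis using that[of 0] by simp
next
  case False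
  define \<beta> where "\<beta> = 1 / (\<alpha> - 1)"
  define K where "K = (c * \<alpha>) powr (- \<beta>)"
  define Q where "Q = (x / v) powr \<beta>"
  \<comment> \<open>This is the minimiser in factored form:
    \<open>\<beta> * \<alpha> = \<beta> + 1\<close> turns
    \<open>(v powr \<alpha>) powr (- \<beta>)\<close> into
    \<open>v powr (- \<beta>) / v\<close>.\<close>
  define l where "l = K * Q / v"
  have x: "0 < x" using False assms by simp
  have pos: "0 < K" "0 < Q" "0 < l" and \<beta>: "0 < \<beta>"
    using assms x by (simp_all add: K_def Q_def l_def \<beta>_def)
  have \<alpha>\<beta>: "\<beta> * \<alpha> = \<beta> + 1"
    using assms by (simp add: \<beta>_def field_simps)
  have Ka: "K powr \<alpha> = K / (c * \<alpha>)"
  proof -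
    have "K powr \<alpha> = (c * \<alpha>) powr (- \<beta> - 1)"
      unfolding K_def powr_powr using \<alpha>\<beta> by (intro arg_cong2[where f = "(powr)"]) auto
    then show ?thesis
      using assms by (simp only: powr_diff K_def) simp
  qed
  have Qa: "Q powr \<alpha> = Q * (x / v)"
    using assms x by (simp add: Q_def powr_powr \<alpha>\<beta> powr_add)
  have R: "rate_constant c \<alpha> = K * (1 - 1 / \<alpha>)"
  proof -
    have "1 / (1 - \<alpha>) = - \<beta>" using assms by (simp add: \<beta>_def field_simps)
    then show ?thesis by (simp add: rate_constant_def K_def)
  qed
  have Xa: "(x / v) powr (\<alpha> / (\<alpha> - 1)) = Q * (x / v)"
  proof -
    have "\<alpha> / (\<alpha> - 1) = \<beta> * \<alpha>" by (simp add: \<beta>_def)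
    then show ?thesis
      unfolding Qa[symmetric] by (simp add: Q_def powr_powr)
  qed
  have "l powr \<alpha> * v powr \<alpha> = (l * v) powr \<alpha>"
    using pos assms by (simp add: powr_mult)
  also have "\<dots> = (K * Q) powr \<alpha>"
    using assms by (simp add: l_def)
  also have "\<dots> = K / (c * \<alpha>) * (Q * (x / v))"
    using pos by (simp add: powr_mult Ka Qa)
  finally have min_term: "l powr \<alpha> * v powr \<alpha> = K / (c * \<alpha>) * (Q * (x / v))" .
  \<comment> \<open>At the minimiser the derivative in \<open>l\<close> vanishes, so the first term
    is \<open>l * x / \<alpha>\<close>; this is the source of the factor
    \<open>1 - 1 / \<alpha>\<close>.\<close>
  have "c * l powr \<alpha> * v powr \<alpha> - l * x = c * (K / (c * \<alpha>) * (Q * (x / v))) - K * (Q * (x / v))"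
    unfolding mult.assoc min_term by (simp add: l_def)
  also have "c * (K / (c * \<alpha>) * (Q * (x / v))) = K * (1 / \<alpha>) * (Q * (x / v))"
    using c by simp
  also have "\<dots> - K * (Q * (x / v)) = - (K * (1 - 1 / \<alpha>)) * (Q * (x / v))"
    by algebra
  finally have "c * l powr \<alpha> * v powr \<alpha> - l * x
      = - rate_constant c \<alpha> * (x / v) powr (\<alpha> / (\<alpha> - 1))"
    unfolding R Xa .
  with pos show ?thesis by (intro that[of l]) auto
qed

text \<open>Substituting the model splits the numerator into \<open>\<theta>\<close> times the
  denominator plus the weighted noise. Where the denominator is 0, every
  \<open>\<phi> k \<omega>\<close> with \<open>k\<close> in \<open>{1..n}\<close> is 0 and both
  sides vanish, so the identity is pointwise on \<open>space M\<close> and not merely almost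
  sure.\<close>

lemma (in stochastic_linear_regression) estimation_error_eq:
  assumes "\<omega> \<in> space M"
  shows "(least_squares_estimator n \<phi> X \<omega> - \<theta>) * (\<Sum>k=1..n. (\<phi> k \<omega>)\<^sup>2) = (\<Sum>k=1..n. \<phi> k \<omega> * \<epsilon> k \<omega>)"
proof (cases "(\<Sum>k=1..n. (\<phi> k \<omega>)\<^sup>2) = 0")
  case True
  then have "\<forall>k\<in>{1..n}. \<phi> k \<omega> = 0"
    by (simp add: sum_nonneg_eq_0_iff)
  then show ?thesis by simp
next
  case False
  have "(\<Sum>k=1..n. \<phi> k \<omega> * X k \<omega>) = (\<Sum>k=1..n. \<theta> * (\<phi> k \<omega>)\<^sup>2 + \<phi> k \<omega> * \<epsilon> k \<omega>)"
    using assms by (intro sum.cong) (auto simp: model power2_eq_square algebra_simps)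
  then have "(\<Sum>k=1..n. \<phi> k \<omega> * X k \<omega>)
      = \<theta> * (\<Sum>k=1..n. (\<phi> k \<omega>)\<^sup>2) + (\<Sum>k=1..n. \<phi> k \<omega> * \<epsilon> k \<omega>)"
    by (simp add: sum.distrib sum_distrib_left)
  with False show ?thesis
    by (simp add: least_squares_estimator_def field_simps)
qed

theorem theorem3p4:
  fixes M :: "'a measure"
    and n :: nat
    and \<theta> \<sigma> \<alpha> c :: real
    and \<phi> \<epsilon> X :: "nat \<Rightarrow> 'a \<Rightarrow> real"
  assumes model: "stochastic_linear_regression M n \<theta> \<sigma> \<phi> \<epsilon> X"
    and \<alpha>: "1 < \<alpha>" "\<alpha> \<le> 2"
    and c: "c > 0"
    and mgf_finite: "\<forall>i\<in>{1..n}. \<forall>t::real. integrable M (\<lambda>\<omega>. exp (t * \<epsilon> i \<omega>))"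
    and mgf_bound: "\<forall>i\<in>{1..n}. \<forall>t::real.
      prob_space.expectation M (\<lambda>\<omega>. exp (t * \<epsilon> i \<omega>)) \<le> exp (c * \<bar>t\<bar> powr \<alpha>)"
  shows "\<forall>x\<ge>0. \<forall>v>0. \<forall>s\<in>{1, -1::real}.
    prob_space.prob M {\<omega> \<in> space M.
        s * ((least_squares_estimator n \<phi> X \<omega> - \<theta>) * (\<Sum>k=1..n. (\<phi> k \<omega>)\<^sup>2)) \<ge> x \<and>
        (\<Sum>k=1..n. \<bar>\<phi> k \<omega>\<bar> powr \<alpha>) \<le> v powr \<alpha>}
      \<le> exp (- rate_constant c \<alpha> * (x / v) powr (\<alpha> / (\<alpha> - 1)))"
proof (intro allI impI ballI)
  interpret stochastic_linear_regression M n \<theta> \<sigma> \<phi> \<epsilon> X by (rule model)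
  fix x v s :: real
  assume x: "0 \<le> x" and v: "0 < v" and s: "s \<in> {1, -1}"
  \<comment> \<open>Here \<open>l\<close> is fixed before any regressor vector \<open>p\<close>, so
    that one bound serves all slices.\<close>
  obtain l where l: "0 \<le> l" and l_eq:
    "c * l powr \<alpha> * v powr \<alpha> - l * x = - rate_constant c \<alpha> * (x / v) powr (\<alpha> / (\<alpha> - 1))"
    using chernoff_exponent_min[OF \<alpha>(1) c v x] .
  let ?P = "\<Pi>\<^sub>M k\<in>{1..n}. (borel :: real measure)"
  let ?b = "exp (- rate_constant c \<alpha> * (x / v) powr (\<alpha> / (\<alpha> - 1)))"
  define A where "A = {z \<in> space (?P \<Otimes>\<^sub>M ?P). x \<le> s * (\<Sum>k=1..n. fst z k * snd z k) \<and>
    (\<Sum>k=1..n. \<bar>fst z k\<bar> powr \<alpha>) \<le> v powr \<alpha>}"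
  have A: "A \<in> sets (?P \<Otimes>\<^sub>M ?P)"
    unfolding A_def by measurable
  have slice: "prob {\<omega> \<in> space M. (p, \<lambda>k\<in>{1..n}. \<epsilon> k \<omega>) \<in> A} \<le> ?b" if p: "p \<in> space ?P" for p
  proof (cases "(\<Sum>k=1..n. \<bar>p k\<bar> powr \<alpha>) \<le> v powr \<alpha>")
    \<comment> \<open>The constraint involves \<open>p\<close> alone, so this slice is
      empty.\<close>
    case False
    then show ?thesis by (simp add: A_def)
  next
    case True
    \<comment> \<open>Moving the sign \<open>s\<close> into the weights treats both tails at once:
      the moment bound covers all real arguments, and
      \<open>\<bar>s * p k\<bar> = \<bar>p k\<bar>\<close>.\<close>
    have "{\<omega> \<in> space M. (p, \<lambda>k\<in>{1..n}. \<epsilon> k \<omega>) \<in> A}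
        = {\<omega> \<in> space M. x \<le> (\<Sum>k=1..n. (s * p k) * \<epsilon> k \<omega>)}"
      using True p by (auto simp: A_def space_pair_measure space_PiM sum_distrib_left mult.assoc)
    also have "prob \<dots> \<le> exp (c * l powr \<alpha> * (\<Sum>k=1..n. \<bar>s * p k\<bar> powr \<alpha>) - l * x)"
      using mgf_finite mgf_bound by (intro weighted_sum_tail_le noise_indep l) auto
    also have "(\<Sum>k=1..n. \<bar>s * p k\<bar> powr \<alpha>) = (\<Sum>k=1..n. \<bar>p k\<bar> powr \<alpha>)"
      using s by (auto simp: abs_mult)
    also have "exp (c * l powr \<alpha> * (\<Sum>k=1..n. \<bar>p k\<bar> powr \<alpha>) - l * x)
        \<le> exp (c * l powr \<alpha> * v powr \<alpha> - l * x)"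
      using True c by (simp add: mult_left_mono)
    finally show ?thesis
      unfolding l_eq .
  qed
  have "{\<omega> \<in> space M.
        s * ((least_squares_estimator n \<phi> X \<omega> - \<theta>) * (\<Sum>k=1..n. (\<phi> k \<omega>)\<^sup>2)) \<ge> x \<and>
        (\<Sum>k=1..n. \<bar>\<phi> k \<omega>\<bar> powr \<alpha>) \<le> v powr \<alpha>}
      = {\<omega> \<in> space M. (\<lambda>k\<in>{1..n}. \<phi> k \<omega>, \<lambda>k\<in>{1..n}. \<epsilon> k \<omega>) \<in> A}"
    by (auto simp: A_def space_pair_measure space_PiM estimation_error_eq simp del: One_nat_def)
  with prob_indep_le_if_slices_le[OF regressors_noise_indep A slice]
  show "prob {\<omega> \<in> space M.
        s * ((least_squares_estimator n \<phi> X \<omega> - \<theta>) * (\<Sum>k=1..n. (\<phi> k \<omega>)\<^sup>2)) \<ge> x \<and>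
        (\<Sum>k=1..n. \<bar>\<phi> k \<omega>\<bar> powr \<alpha>) \<le> v powr \<alpha>} \<le> ?b"
    by simp
qed

end
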